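(* Let $n$ be a positive integer. In any tiling of the unit square by $n$ squares that has the minimal tile property, the side length of the smallest tile is at least $1/2^n$.
   Context: A tiling of the unit square by $n$ squares is a collection of $n$ closed squares of positive side length (not necessarily all the same size, with sides parallel to the sides of the unit square) that have pairwise disjoint interiors and whose union is the unit square; the squares are called tiles. A tiling has the minimal tile property (MTP) if the smallest tile can tile all the other tiles, i.e., the side length of every tile is a positive integer multiple of the side length of the smallest tile. *)

theory Defs
  imports "HOL-Analysis.Analysis"
begin

definition square :: "real \<Rightarrow> real \<Rightarrow> real \<Rightarrow> (real \<times> real) set" where
  "square x y s = {x..x + s} \<times> {y..y + s}"

definition has_side :: "(real \<times> real) set \<Rightarrow> real \<Rightarrow> bool" where
  "has_side Q s \<longleftrightarrow> s > 0 \<and> (\<exists>x y. Q = square x y s)"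

definition is_square :: "(real \<times> real) set \<Rightarrow> bool" where
  "is_square Q \<longleftrightarrow> (\<exists>s. has_side Q s)"

definition side_length :: "(real \<times> real) set \<Rightarrow> real" where
  "side_length Q = (THE s. has_side Q s)"

definition unit_square :: "(real \<times> real) set" where
  "unit_square = square 0 0 1"

text \<open>
  A set of tiles (rather than a family) loses nothing: two equal squares of positive side
  length do not have disjoint interiors.
\<close>

definition is_tiling :: "nat \<Rightarrow> (real \<times> real) set set \<Rightarrow> bool" where
  "is_tiling n T \<longleftrightarrow>
     finite T \<and> card T = n \<and>
     (\<forall>Q\<in>T. is_square Q) \<and>
     (\<forall>Q\<in>T. \<forall>R\<in>T. Q \<noteq> R \<longrightarrow> interior Q \<inter> interior R = {}) \<and>
     \<Union>T = unit_square"

definition min_side :: "(real \<times> real) set set \<Rightarrow> real" where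
  "min_side T = Min (side_length ` T)"

definition minimal_tile_property :: "(real \<times> real) set set \<Rightarrow> bool" where
  "minimal_tile_property T \<longleftrightarrow>
     (\<forall>Q\<in>T. \<exists>k::nat. k > 0 \<and> side_length Q = real k * min_side T)"

lemma has_side_unique:
  assumes "has_side Q s" "has_side Q t"
  shows "s = t"
proof -
  from assms obtain x y x' y' where
    "s > 0" "t > 0" "{x..x + s} \<times> {y..y + s} = {x'..x' + t} \<times> {y'..y' + t}"
    by (auto simp: has_side_def square_def)
  then have "{x..x + s} = {x'..x' + t}"
    by (auto simp: times_eq_iff)
  with \<open>s > 0\<close> \<open>t > 0\<close> show ?thesis
    by (auto simp: Icc_eq_Icc)
qed

lemma side_length_eq: "has_side Q s \<Longrightarrow> side_length Q = s"
  unfolding side_length_def using has_side_unique by blast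

lemma side_length_square: "s > 0 \<Longrightarrow> side_length (square x y s) = s"
  by (rule side_length_eq) (auto simp: has_side_def)

end

theory Submission
  imports Defs
begin

text \<open>
  A tiling is an electrical network in the manner of Brooks, Smith, Stone and Tutte: the nodes are
  the heights at which tiles begin or end, each tile is an edge from its bottom height to its top
  height, and the side \<open>s\<close> of a tile is both the potential difference across that edge and the
  current through it. The currents balance at every height strictly between 0 and 1, because the
  tiles resting on a horizontal line and the tiles hanging from it have the same total width. As
  the height 1 receives and the height 0 emits total current 1, the currents form a circulation
  once these two heights are identified (\<open>balance\<close>).

  Consequently it is enough to find an integer \<open>m\<close> with \<open>0 < m \<le> 2 ^ n\<close> for which \<open>m * s\<close> is an
  integer for every tile: then \<open>m * s \<ge> 1\<close>, so \<open>s \<ge> 1 / 2 ^ n\<close>. The classical choice of \<open>m\<close> is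
  the number of spanning trees of the network. The proof here replaces determinants by a pigeonhole
  argument (\<open>common_denominator_of_network\<close>).

  For every integer \<open>k\<close>, consider integer potentials that are \<open>k\<close> higher at the top than at the
  bottom. Their differences along the tiles need not be a circulation, but they are one up to a
  correction with entries 0 and 1 only (\<open>zero_one_representative\<close>): any integer vector on the edges
  can be moved into the cube by adding circulations and potential differences, since at every stage
  an entry that is too large or too small lies on a directed cycle or a directed cut along which all
  entries move the right way (\<open>directed_cycle_or_cut\<close>, a form of Minty's colouring lemma).
  There are only \<open>2 ^ n\<close> corrections, so two values \<open>k < l \<le> 2 ^ n\<close> share one. The difference of
  their potentials is an integer potential with drop \<open>m = l - k\<close> whose differences are a circulation.
  So are the numbers \<open>m * s\<close>, which are the differences of \<open>m\<close> times the height. A network with a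
  prescribed drop has only one such flow: the difference of two is orthogonal to itself. Hence the
  numbers \<open>m * s\<close> are integers.
\<close>

section \<open>Directed cycles and directed cuts\<close>

text \<open>
  Arcs are indexed by \<open>I\<close>, the arc \<open>i\<close> leading from \<open>a i\<close> to \<open>b i\<close>, so that parallel arcs and loops
  are allowed. Only the set of arcs of a trail is recorded; forbidding repeated arcs makes
  its indicator function a 0/1 flow.
\<close>

inductive trail :: "('i \<Rightarrow> 'v) \<Rightarrow> ('i \<Rightarrow> 'v) \<Rightarrow> 'i set \<Rightarrow> 'v \<Rightarrow> 'i set \<Rightarrow> 'v \<Rightarrow> bool"
  for a b :: "'i \<Rightarrow> 'v" and I :: "'i set" and u :: 'v
  where
    start: "trail a b I u {} u"
  | extend: "\<lbrakk>trail a b I u S (a i); i \<in> I; i \<notin> S\<rbrakk> \<Longrightarrow> trail a b I u (insert i S) (b i)"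

lemma trail_subset: "trail a b I u S v \<Longrightarrow> finite S \<and> S \<subseteq> I"
  by (induction rule: trail.induct) auto

lemma trail_sum:
  fixes h :: "'v \<Rightarrow> real"
  assumes "trail a b I u S v"
  shows "(\<Sum>i\<in>S. h (b i) - h (a i)) = h v - h u"
  using assms
proof (induction rule: trail.induct)
  case (extend S i)
  then show ?case using trail_subset[OF extend.hyps(1)] by simp
qed simp

text \<open>
  Cutting a trail just before it uses \<open>i\<close>. This shows that reachability by trails is closed under
  following any arc, used before or not.
\<close>

lemma trail_before_arc:
  assumes "trail a b I u S v" "i \<in> S"
  shows "\<exists>S'. i \<notin> S' \<and> trail a b I u S' (a i)"
  using assms by (induction rule: trail.induct) auto

lemma trail_to_head:
  assumes "trail a b I u S (a i)" "i \<in> I"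
  shows "\<exists>S'. trail a b I u S' (b i)"
  using assms trail_before_arc[OF assms(1)] trail.extend by metis

text \<open>
  Minty's dichotomy: either the tail of \<open>e\<close> can be reached from its head, and \<open>e\<close> closes a directed
  cycle, or the set \<open>R\<close> of nodes reachable from the head is one that no arc leaves and that \<open>e\<close>
  enters. Cycles are expressed by the vanishing of the sum of potential differences.
\<close>

lemma directed_cycle_or_cut:
  fixes a b :: "'i \<Rightarrow> 'v"
  assumes "e \<in> I"
  obtains (cycle) C where "C \<subseteq> I" "e \<in> C" "\<And>h :: 'v \<Rightarrow> real. (\<Sum>i\<in>C. h (b i) - h (a i)) = 0"
  | (cut) R where "a e \<notin> R" "b e \<in> R" "\<And>i. i \<in> I \<Longrightarrow> a i \<in> R \<Longrightarrow> b i \<in> R"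
proof (cases "\<exists>S. trail a b I (b e) S (a e)")
  case True
  then obtain S where "e \<notin> S" "trail a b I (b e) S (a e)"
    using trail_before_arc by metis
  then have "trail a b I (b e) (insert e S) (b e)"
    using assms by (rule_tac trail.extend)
  from trail_subset[OF this] trail_sum[OF this] show ?thesis
    by (intro cycle[of "insert e S"]) auto
next
  case False
  then show ?thesis
    using trail_to_head[of a b I "b e"] trail.start[of a b I "b e"]
    by (intro cut[of "{v. \<exists>S. trail a b I (b e) S v}"]) blast+
qed

section \<open>Reduction to vectors with entries 0 and 1\<close>

text \<open>
  Conservation of flow at every node, expressed as orthogonality to all potential differences.
\<close>

definition circulation :: "'i set \<Rightarrow> ('i \<Rightarrow> 'v) \<Rightarrow> ('i \<Rightarrow> 'v) \<Rightarrow> ('i \<Rightarrow> real) \<Rightarrow> bool" where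
  "circulation I a b f \<longleftrightarrow> (\<forall>h :: 'v \<Rightarrow> real. (\<Sum>i\<in>I. f i * (h (b i) - h (a i))) = 0)"

lemma circulation_diff:
  "circulation I a b f \<Longrightarrow> circulation I a b g \<Longrightarrow> circulation I a b (\<lambda>i. f i - g i)"
  by (simp add: circulation_def left_diff_distrib sum_subtractf)

text \<open>
  The sign \<open>\<sigma> i\<close> is a direction in which \<open>z i\<close> can move by one without getting further from
  \<open>{0, 1}\<close>. Reversing the edges with \<open>\<sigma> i = - 1\<close> turns a directed cycle into a circulation, and a
  directed cut into a potential difference, with entries 0 or \<open>\<sigma> i\<close>. Both kinds of change leave
  \<open>z\<close> in the same class modulo circulations and potential differences.
\<close>

lemma step_towards_unit_cube:
  fixes a b :: "'i \<Rightarrow> 'v" and z :: "'i \<Rightarrow> int"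
  assumes "finite I" "e \<in> I"
  defines "\<sigma> \<equiv> (\<lambda>i. if z i \<le> 0 then 1 else - 1 :: int)"
  obtains w :: "'i \<Rightarrow> int" and \<psi> :: "'v \<Rightarrow> int"
  where "\<forall>i\<in>I. w i = 0 \<or> w i = \<sigma> i" "w e = \<sigma> e"
    "circulation I a b (\<lambda>i. of_int (w i - (\<psi> (b i) - \<psi> (a i))))"
proof -
  define a' where "a' = (\<lambda>i. if z i \<le> 0 then a i else b i)"
  define b' where "b' = (\<lambda>i. if z i \<le> 0 then b i else a i)"
  from \<open>e \<in> I\<close> show thesis
  proof (cases rule: directed_cycle_or_cut[where a = a' and b = b'])
    case (cycle C)
    have "(\<Sum>i\<in>I. real_of_int (if i \<in> C then \<sigma> i else 0) * (h (b i) - h (a i))) = 0"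
      for h :: "'v \<Rightarrow> real"
    proof -
      have "(\<Sum>i\<in>I. real_of_int (if i \<in> C then \<sigma> i else 0) * (h (b i) - h (a i)))
          = (\<Sum>i\<in>I. if i \<in> C then h (b' i) - h (a' i) else 0)"
        by (intro sum.cong) (auto simp: \<sigma>_def a'_def b'_def)
      also have "\<dots> = (\<Sum>i\<in>C. h (b' i) - h (a' i))"
        using \<open>finite I\<close> \<open>C \<subseteq> I\<close> by (simp add: sum.inter_restrict[symmetric] Int_absorb1)
      finally show ?thesis using cycle by simp
    qed
    then show thesis
      using \<open>e \<in> C\<close> by (intro that[of "\<lambda>i. if i \<in> C then \<sigma> i else 0" "\<lambda>_. 0"])
        (auto simp: circulation_def)
  next
    case (cut R)
    define \<psi> :: "'v \<Rightarrow> int" where "\<psi> = (\<lambda>v. if v \<in> R then 1 else 0)"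
    show thesis
    proof (rule that[of "\<lambda>i. \<psi> (b i) - \<psi> (a i)" \<psi>], intro ballI)
      fix i assume "i \<in> I"
      with cut(3)[of i] show "\<psi> (b i) - \<psi> (a i) = 0 \<or> \<psi> (b i) - \<psi> (a i) = \<sigma> i"
        by (cases "z i \<le> 0") (auto simp: \<psi>_def \<sigma>_def a'_def b'_def)
    next
      show "\<psi> (b e) - \<psi> (a e) = \<sigma> e"
        using cut(1,2) by (auto simp: \<psi>_def \<sigma>_def a'_def b'_def split: if_splits)
    qed (simp add: circulation_def)
  qed
qed

text \<open>
  The total distance of the entries from \<open>{0, 1}\<close> decreases with every step applied at an
  entry outside \<open>{0, 1}\<close>. The representative is given by the set \<open>A\<close> of its entries 1.
\<close>

lemma zero_one_representative:
  fixes a b :: "'i \<Rightarrow> 'v" and z :: "'i \<Rightarrow> int"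
  assumes "finite I"
  shows "\<exists>A \<phi>. A \<subseteq> I \<and>
    circulation I a b (\<lambda>i. of_int (z i - (if i \<in> A then 1 else 0) - (\<phi> (b i) - \<phi> (a i))))"
proof (induction "\<Sum>i\<in>I. nat (max (- z i) (z i - 1))" arbitrary: z rule: less_induct)
  case less
  show ?case
  proof (cases "\<forall>i\<in>I. z i = 0 \<or> z i = 1")
    case True
    then show ?thesis
      by (intro exI[of _ "{i\<in>I. z i = 1}"] exI[of _ "\<lambda>_. 0"])
        (auto simp: circulation_def intro!: sum.neutral)
  next
    case False
    then obtain e where e: "e \<in> I" "z e \<noteq> 0" "z e \<noteq> 1" by blast
    obtain w \<psi> where w: "\<forall>i\<in>I. w i = 0 \<or> w i = (if z i \<le> 0 then 1 else - 1)"
      "w e = (if z e \<le> 0 then 1 else - 1)"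
      and \<psi>: "circulation I a b (\<lambda>i. of_int (w i - (\<psi> (b i) - \<psi> (a i))))"
      by (rule step_towards_unit_cube[OF assms e(1), where a = a and b = b and z = z]) blast
    have "(\<Sum>i\<in>I. nat (max (- (z i + w i)) (z i + w i - 1))) < (\<Sum>i\<in>I. nat (max (- z i) (z i - 1)))"
    proof (rule sum_strict_mono_ex1[OF assms])
      show "\<forall>i\<in>I. nat (max (- (z i + w i)) (z i + w i - 1)) \<le> nat (max (- z i) (z i - 1))"
        using w(1) by (fastforce split: if_splits)
      show "\<exists>i\<in>I. nat (max (- (z i + w i)) (z i + w i - 1)) < nat (max (- z i) (z i - 1))"
        using w(2) e by (intro bexI[of _ e]) (auto split: if_splits)
    qed
    from less[OF this] obtain A \<phi> where "A \<subseteq> I" and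
      "circulation I a b
        (\<lambda>i. of_int (z i + w i - (if i \<in> A then 1 else 0) - (\<phi> (b i) - \<phi> (a i))))"
      by blast
    from circulation_diff[OF this(2) \<psi>] \<open>A \<subseteq> I\<close> show ?thesis
      by (intro exI[of _ A] exI[of _ "\<lambda>v. \<phi> v - \<psi> v"]) (simp add: algebra_simps)
  qed
qed

section \<open>The pigeonhole argument\<close>

text \<open>
  Here \<open>y i\<close> and \<open>y i + s i\<close> are the potentials at the ends of the edge \<open>i\<close>, and its current is again
  \<open>s i\<close>. The number \<open>m\<close> is the difference of two integers from \<open>{0..2 ^ card I}\<close> that have the same
  0/1 representative.
\<close>

lemma common_denominator_of_network:
  fixes y s :: "'i \<Rightarrow> real"
  assumes "finite I"
    and pos: "\<And>i. i \<in> I \<Longrightarrow> s i > 0"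
    and range: "\<And>i. i \<in> I \<Longrightarrow> 0 \<le> y i \<and> y i + s i \<le> 1"
    and balance: "\<And>h :: real \<Rightarrow> real. h 0 = h 1 \<Longrightarrow> (\<Sum>i\<in>I. s i * (h (y i + s i) - h (y i))) = 0"
  shows "\<exists>m. 0 < m \<and> m \<le> (2::nat) ^ card I \<and> (\<forall>i\<in>I. real m * s i \<in> \<int>)"
proof -
  \<comment> \<open>The nodes 1 and 0 are glued together by \<open>q\<close>. A drop of \<open>k\<close> then cannot be part of the
    potential, and is carried as the integer vector \<open>z k\<close> on the edges that end at 1.\<close>
  define q :: "real \<Rightarrow> real" where "q = (\<lambda>v. if v = 1 then 0 else v)"
  define z :: "nat \<Rightarrow> real \<Rightarrow> int" where "z = (\<lambda>k v. if v = 1 then int k else 0)"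
  define good :: "nat \<Rightarrow> 'i set \<Rightarrow> (real \<Rightarrow> int) \<Rightarrow> bool" where
    "good = (\<lambda>k A \<phi>. A \<subseteq> I \<and> circulation I (\<lambda>i. q (y i)) (\<lambda>i. q (y i + s i))
      (\<lambda>i. of_int (z k (y i + s i) - (if i \<in> A then 1 else 0)
        - (\<phi> (q (y i + s i)) - \<phi> (q (y i))))))"
  have "\<forall>k. \<exists>A \<phi>. good k A \<phi>"
    unfolding good_def by (intro allI zero_one_representative[OF \<open>finite I\<close>])
  then obtain A \<phi> where good: "\<And>k. good k (A k) (\<phi> k)" by metis
  from good have A: "\<And>k. A k \<subseteq> I"
    and \<phi>: "\<And>k. circulation I (\<lambda>i. q (y i)) (\<lambda>i. q (y i + s i))
      (\<lambda>i. of_int (z k (y i + s i) - (if i \<in> A k then 1 else 0)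
        - (\<phi> k (q (y i + s i)) - \<phi> k (q (y i)))))"
    by (simp_all only: good_def)
  have "\<not> inj_on A {..2 ^ card I}"
  proof
    assume "inj_on A {..2 ^ card I}"
    moreover have "A ` {..2 ^ card I} \<subseteq> Pow I" using A by blast
    ultimately have "card {..(2::nat) ^ card I} \<le> card (Pow I)"
      using \<open>finite I\<close> by (intro card_inj_on_le) auto
    then show False using \<open>finite I\<close> by (simp add: card_Pow)
  qed
  then obtain k l where kl: "k < l" "l \<le> 2 ^ card I" "A k = A l"
    unfolding inj_on_def by (metis atMost_iff linorder_neqE_nat)
  \<comment> \<open>The difference of the two potentials, with 0 and 1 separated again; subtracting the
    multiple of the height with the same drop gives \<open>F\<close>, a function on the glued network.\<close>
  define \<Phi> :: "real \<Rightarrow> int" where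
    "\<Phi> = (\<lambda>v. z l v - z k v - (\<phi> l (q v) - \<phi> k (q v)))"
  define F where "F = (\<lambda>v. real_of_int (\<Phi> v) - real (l - k) * v)"
  have F01: "F 0 = F 1" using \<open>k < l\<close> by (simp add: F_def \<Phi>_def z_def q_def of_nat_diff)
  have Fq: "F (q v) = F v" for v using F01 by (simp add: q_def)
  have "y i \<noteq> 1" if "i \<in> I" for i using pos[OF that] range[OF that] by auto
  then have zy: "z j (y i) = 0" if "i \<in> I" for i j using that by (simp add: z_def)
  \<comment> \<open>Both flows, the differences of \<open>\<Phi>\<close> and the multiples of \<open>s\<close>, are orthogonal to the
    differences of \<open>F\<close>, and these are the differences of the two flows. So \<open>F\<close> has energy zero.\<close>
  have "(\<Sum>i\<in>I. of_int (\<Phi> (y i + s i) - \<Phi> (y i)) * (F (y i + s i) - F (y i))) = 0"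
  proof -
    have "(\<Sum>i\<in>I. of_int (\<Phi> (y i + s i) - \<Phi> (y i)) * (F (y i + s i) - F (y i)))
      = (\<Sum>i\<in>I. (of_int (z l (y i + s i) - (if i \<in> A l then 1 else 0)
        - (\<phi> l (q (y i + s i)) - \<phi> l (q (y i)))) -
        of_int (z k (y i + s i) - (if i \<in> A k then 1 else 0)
        - (\<phi> k (q (y i + s i)) - \<phi> k (q (y i))))) * (F (q (y i + s i)) - F (q (y i))))"
      by (intro sum.cong refl) (simp add: \<Phi>_def zy Fq \<open>A k = A l\<close>)
    also have "\<dots> = 0"
      using circulation_diff[OF \<phi> \<phi>, of l k] unfolding circulation_def by blast
    finally show ?thesis .
  qed
  moreover have "(\<Sum>i\<in>I. real (l - k) * s i * (F (y i + s i) - F (y i))) = 0"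
    using balance[OF F01] by (simp add: mult.assoc sum_distrib_left[symmetric])
  moreover have "(F (y i + s i) - F (y i))\<^sup>2
      = of_int (\<Phi> (y i + s i) - \<Phi> (y i)) * (F (y i + s i) - F (y i))
        - real (l - k) * s i * (F (y i + s i) - F (y i))" for i
    unfolding left_diff_distrib[symmetric] power2_eq_square
    by (intro arg_cong2[where f = "(*)"]) (simp_all add: F_def algebra_simps)
  ultimately have "(\<Sum>i\<in>I. (F (y i + s i) - F (y i))\<^sup>2) = 0"
    by (simp add: sum_subtractf)
  then have "real (l - k) * s i = real_of_int (\<Phi> (y i + s i) - \<Phi> (y i))" if "i \<in> I" for i
    using that \<open>finite I\<close> by (simp add: sum_nonneg_eq_0_iff F_def algebra_simps)
  with kl show ?thesis by (intro exI[of _ "l - k"]) auto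
qed

section \<open>The network of a tiling\<close>

locale placed_tiling =
  fixes T :: "(real \<times> real) set set" and x y s :: "(real \<times> real) set \<Rightarrow> real"
  assumes finite_tiles: "finite T"
    and tile: "Q \<in> T \<Longrightarrow> Q = square (x Q) (y Q) (s Q)"
    and side_pos: "Q \<in> T \<Longrightarrow> s Q > 0"
    and interiors_disjoint: "\<lbrakk>Q \<in> T; R \<in> T; Q \<noteq> R\<rbrakk> \<Longrightarrow> interior Q \<inter> interior R = {}"
    and covers: "\<Union>T = unit_square"
begin

lemma mem_tile:
  "Q \<in> T \<Longrightarrow> (u, v) \<in> Q \<longleftrightarrow> x Q \<le> u \<and> u \<le> x Q + s Q \<and> y Q \<le> v \<and> v \<le> y Q + s Q"
  by (subst tile) (auto simp: square_def)

lemma mem_interior_tile: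
  "Q \<in> T \<Longrightarrow> (u, v) \<in> interior Q \<longleftrightarrow> x Q < u \<and> u < x Q + s Q \<and> y Q < v \<and> v < y Q + s Q"
  by (subst tile) (auto simp: square_def interior_Times)

lemma tile_range:
  assumes "Q \<in> T"
  shows "0 \<le> x Q" "x Q + s Q \<le> 1" "0 \<le> y Q" "y Q + s Q \<le> 1"
proof -
  have "(x Q, y Q) \<in> Q" "(x Q + s Q, y Q + s Q) \<in> Q"
    using side_pos[OF assms] by (auto simp: mem_tile[OF assms])
  then have "(x Q, y Q) \<in> unit_square" "(x Q + s Q, y Q + s Q) \<in> unit_square"
    using assms covers by blast+
  then show "0 \<le> x Q" "x Q + s Q \<le> 1" "0 \<le> y Q" "y Q + s Q \<le> 1"
    by (auto simp: unit_square_def square_def)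
qed

definition levels :: "real set" where
  "levels = {0, 1} \<union> y ` T \<union> (\<lambda>Q. y Q + s Q) ` T"

lemma finite_levels: "finite levels"
  by (simp add: levels_def finite_tiles)

lemma levels_isolated:
  obtains d where "d > 0" "\<And>w. w \<in> levels \<Longrightarrow> w = v \<or> w \<le> v - d \<or> w \<ge> v + d"
proof -
  obtain d where pos: "d > 0" and d: "\<And>w. w \<in> levels \<Longrightarrow> w \<noteq> v \<Longrightarrow> d \<le> dist v w"
    using finite_set_avoid[OF finite_levels] by metis
  have "w = v \<or> w \<le> v - d \<or> w \<ge> v + d" if "w \<in> levels" for w
    using d[OF that] by (auto simp: dist_real_def abs_if split: if_splits)
  with pos show thesis by (rule that)
qed

text \<open>
  A horizontal line that meets no horizontal side of a tile is cut by the tiles into segments that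
  overlap in at most endpoints, because overlapping segments at an interior height would give
  overlapping interiors.
\<close>

lemma generic_slice:
  assumes "0 < c" "c < 1" "c \<notin> levels"
  shows "(\<Sum>Q | Q \<in> T \<and> y Q < c \<and> c < y Q + s Q. s Q) = 1"
proof -
  define J where "J = {Q \<in> T. y Q < c \<and> c < y Q + s Q}"
  have "(\<Union>Q\<in>J. {x Q..x Q + s Q}) = {0..1}"
  proof (intro equalityI subsetI)
    fix u assume "u \<in> (\<Union>Q\<in>J. {x Q..x Q + s Q})"
    then show "u \<in> {0..1}" using tile_range by (force simp: J_def)
  next
    fix u :: real assume "u \<in> {0..1}"
    then have "(u, c) \<in> unit_square" using assms by (auto simp: unit_square_def square_def)
    then obtain Q where Q: "Q \<in> T" "(u, c) \<in> Q" using covers by blast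
    moreover have "c \<noteq> y Q" "c \<noteq> y Q + s Q" using assms(3) Q(1) by (auto simp: levels_def)
    ultimately show "u \<in> (\<Union>Q\<in>J. {x Q..x Q + s Q})"
      by (auto simp: J_def mem_tile intro!: bexI[of _ Q])
  qed
  moreover have "measure lebesgue (\<Union>Q\<in>J. {x Q..x Q + s Q})
      = (\<Sum>Q\<in>J. measure lebesgue {x Q..x Q + s Q})"
  proof (rule measure_negligible_finite_Union_image)
    show "finite J" using finite_tiles by (simp add: J_def)
    show "pairwise (\<lambda>Q R. negligible ({x Q..x Q + s Q} \<inter> {x R..x R + s R})) J"
    proof (rule pairwiseI)
      fix Q R assume "Q \<in> J" "R \<in> J" "Q \<noteq> R"
      have "{x Q..x Q + s Q} \<inter> {x R..x R + s R} \<subseteq> {x Q, x Q + s Q, x R, x R + s R}"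
      proof
        fix u assume u: "u \<in> {x Q..x Q + s Q} \<inter> {x R..x R + s R}"
        have "(u, c) \<notin> interior Q \<or> (u, c) \<notin> interior R"
          using interiors_disjoint[of Q R] \<open>Q \<in> J\<close> \<open>R \<in> J\<close> \<open>Q \<noteq> R\<close> by (auto simp: J_def)
        with u \<open>Q \<in> J\<close> \<open>R \<in> J\<close> show "u \<in> {x Q, x Q + s Q, x R, x R + s R}"
          by (auto simp: J_def mem_interior_tile)
      qed
      then show "negligible ({x Q..x Q + s Q} \<inter> {x R..x R + s R})"
        using finite_subset negligible_finite by blast
    qed
  qed auto
  ultimately have "(\<Sum>Q\<in>J. measure lebesgue {x Q..x Q + s Q}) = 1" by simp
  moreover have "measure lebesgue {x Q..x Q + s Q} = s Q" if "Q \<in> J" for Q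
    using that side_pos[of Q] by (simp add: J_def)
  ultimately show ?thesis by (simp add: J_def)
qed

text \<open>
  Moving the line slightly off the height \<open>v\<close>, downwards or upwards, makes it generic; the tiles it
  meets are those just below or just above \<open>v\<close>. Tiles that extend on both sides of \<open>v\<close> are met
  either way, so comparing the two slices gives conservation of current.
\<close>

lemma slice_below:
  assumes "0 < v" "v \<le> 1"
  shows "(\<Sum>Q | Q \<in> T \<and> y Q < v \<and> v \<le> y Q + s Q. s Q) = 1"
proof -
  obtain d where d: "d > 0"
    and far: "\<And>w. w \<in> levels \<Longrightarrow> w = v \<or> w \<le> v - d \<or> w \<ge> v + d"
    by (rule levels_isolated[of v]) blast
  define c where "c = v - d / 2"
  have "0 \<in> levels" by (simp add: levels_def)
  from far[OF this] have "0 < c" "c < 1" using assms d by (auto simp: c_def)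
  moreover have "c \<notin> levels" using far[of c] d by (auto simp: c_def)
  ultimately have "(\<Sum>Q | Q \<in> T \<and> y Q < c \<and> c < y Q + s Q. s Q) = 1" by (rule generic_slice)
  moreover have "y Q < c \<and> c < y Q + s Q \<longleftrightarrow> y Q < v \<and> v \<le> y Q + s Q" if "Q \<in> T" for Q
    using far[of "y Q"] far[of "y Q + s Q"] that d by (auto simp: levels_def c_def)
  ultimately show ?thesis by (simp cong: conj_cong)
qed

lemma slice_above:
  assumes "0 \<le> v" "v < 1"
  shows "(\<Sum>Q | Q \<in> T \<and> y Q \<le> v \<and> v < y Q + s Q. s Q) = 1"
proof -
  obtain d where d: "d > 0"
    and far: "\<And>w. w \<in> levels \<Longrightarrow> w = v \<or> w \<le> v - d \<or> w \<ge> v + d"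
    by (rule levels_isolated[of v]) blast
  define c where "c = v + d / 2"
  have "1 \<in> levels" by (simp add: levels_def)
  from far[OF this] have "0 < c" "c < 1" using assms d by (auto simp: c_def)
  moreover have "c \<notin> levels" using far[of c] d by (auto simp: c_def)
  ultimately have "(\<Sum>Q | Q \<in> T \<and> y Q < c \<and> c < y Q + s Q. s Q) = 1" by (rule generic_slice)
  moreover have "y Q < c \<and> c < y Q + s Q \<longleftrightarrow> y Q \<le> v \<and> v < y Q + s Q" if "Q \<in> T" for Q
    using far[of "y Q"] far[of "y Q + s Q"] that d by (auto simp: levels_def c_def)
  ultimately show ?thesis by (simp cong: conj_cong)
qed

definition width_ending_at :: "real \<Rightarrow> real" where
  "width_ending_at v = (\<Sum>Q | Q \<in> T \<and> y Q + s Q = v. s Q)"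

definition width_starting_at :: "real \<Rightarrow> real" where
  "width_starting_at v = (\<Sum>Q | Q \<in> T \<and> y Q = v. s Q)"

lemma width_at_interior_level:
  assumes "0 < v" "v < 1"
  shows "width_ending_at v = width_starting_at v"
proof -
  let ?C = "{Q \<in> T. y Q < v \<and> v < y Q + s Q}"
  have "{Q \<in> T. y Q < v \<and> v \<le> y Q + s Q} = ?C \<union> {Q \<in> T. y Q + s Q = v}"
    using side_pos by force
  then have "1 = sum s ?C + width_ending_at v"
    using slice_below[of v] assms finite_tiles unfolding width_ending_at_def
    by (subst sum.union_disjoint[symmetric]) auto
  moreover have "{Q \<in> T. y Q \<le> v \<and> v < y Q + s Q} = ?C \<union> {Q \<in> T. y Q = v}"
    using side_pos by force
  then have "1 = sum s ?C + width_starting_at v"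
    using slice_above[of v] assms finite_tiles unfolding width_starting_at_def
    by (subst sum.union_disjoint[symmetric]) auto
  ultimately show ?thesis by simp
qed

lemma width_at_boundary:
  "width_ending_at 0 = 0" "width_starting_at 0 = 1"
  "width_ending_at 1 = 1" "width_starting_at 1 = 0"
proof -
  have "{Q \<in> T. y Q + s Q = 0} = {}" "{Q \<in> T. y Q = 1} = {}"
    using tile_range(3,4) side_pos by force+
  then show "width_ending_at 0 = 0" "width_starting_at 1 = 0"
    by (simp_all only: width_ending_at_def width_starting_at_def sum.empty)
  have "{Q \<in> T. y Q = 0} = {Q \<in> T. y Q \<le> 0 \<and> 0 < y Q + s Q}"
    using tile_range(3) side_pos by force
  then show "width_starting_at 0 = 1"
    using slice_above[of 0] by (simp add: width_starting_at_def)
  have "{Q \<in> T. y Q + s Q = 1} = {Q \<in> T. y Q < 1 \<and> 1 \<le> y Q + s Q}"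
    using tile_range(4) side_pos by force
  then show "width_ending_at 1 = 1"
    using slice_below[of 1] by (simp add: width_ending_at_def)
qed

text \<open>
  Collecting the terms by the value of the height turns the sum into one over the levels, weighted by
  the net current, which is 1 at the top, \<open>- 1\<close> at the bottom and 0 in between.
\<close>

lemma balance:
  fixes h :: "real \<Rightarrow> real"
  assumes "h 0 = h 1"
  shows "(\<Sum>Q\<in>T. s Q * (h (y Q + s Q) - h (y Q))) = 0"
proof -
  have top: "(\<Sum>Q\<in>T. s Q * h (y Q + s Q)) = (\<Sum>v\<in>levels. h v * width_ending_at v)"
    unfolding width_ending_at_def sum_distrib_left
    by (subst sum.group[symmetric, OF finite_tiles finite_levels, of "\<lambda>Q. y Q + s Q"])
      (auto simp: levels_def mult.commute intro!: sum.cong)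
  have bot: "(\<Sum>Q\<in>T. s Q * h (y Q)) = (\<Sum>v\<in>levels. h v * width_starting_at v)"
    unfolding width_starting_at_def sum_distrib_left
    by (subst sum.group[symmetric, OF finite_tiles finite_levels, of y])
      (auto simp: levels_def mult.commute intro!: sum.cong)
  have "(\<Sum>Q\<in>T. s Q * (h (y Q + s Q) - h (y Q)))
      = (\<Sum>v\<in>levels. h v * (width_ending_at v - width_starting_at v))"
    by (simp add: right_diff_distrib sum_subtractf top bot)
  also have "\<dots> = (\<Sum>v\<in>{0, 1}. h v * (width_ending_at v - width_starting_at v))"
  proof (rule sum.mono_neutral_right[OF finite_levels])
    show "\<forall>v\<in>levels - {0, 1}. h v * (width_ending_at v - width_starting_at v) = 0"
    proof
      fix v assume v: "v \<in> levels - {0, 1}"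
      then have "0 \<le> v \<and> v \<le> 1"
        using tile_range(3,4) side_pos by (fastforce simp: levels_def)
      with v show "h v * (width_ending_at v - width_starting_at v) = 0"
        by (simp add: width_at_interior_level)
    qed
  qed (simp add: levels_def)
  also have "\<dots> = 0" using assms by (simp add: width_at_boundary)
  finally show ?thesis .
qed

end

theorem theorem1:
  fixes n :: nat and T :: "(real \<times> real) set set"
  assumes "n > 0"
    and "is_tiling n T"
    and "minimal_tile_property T"
  shows "min_side T \<ge> 1 / 2 ^ n"
proof -
  from assms(2) have T: "finite T" "card T = n" by (auto simp: is_tiling_def)
  have "\<forall>Q\<in>T. \<exists>s x y. s > 0 \<and> Q = square x y s"
    using assms(2) by (auto simp: is_tiling_def is_square_def has_side_def)
  then obtain s x y where placed: "\<And>Q. Q \<in> T \<Longrightarrow> s Q > 0 \<and> Q = square (x Q) (y Q) (s Q)"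
    by metis
  interpret placed_tiling T x y s
    by unfold_locales (use assms(2) placed in \<open>auto simp: is_tiling_def\<close>)
  obtain m where m: "0 < m" "m \<le> 2 ^ n" "\<And>Q. Q \<in> T \<Longrightarrow> real m * s Q \<in> \<int>"
    using common_denominator_of_network[of T s y] finite_tiles side_pos tile_range balance T by auto
  have "1 / 2 ^ n \<le> side_length Q" if "Q \<in> T" for Q
  proof -
    have "0 < real m * s Q" using m(1) side_pos[OF that] by simp
    with m(3)[OF that] have "1 \<le> real m * s Q" by (auto elim!: Ints_cases)
    moreover have "real m \<le> 2 ^ n" using of_nat_mono[OF m(2), where 'a = real] by simp
    then have "real m * s Q \<le> 2 ^ n * s Q" using side_pos[OF that] by simp
    moreover have "s Q = side_length Q"
      using tile[OF that] side_length_square[OF side_pos[OF that]] by metis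
    ultimately show ?thesis by (simp add: field_simps)
  qed
  moreover have "T \<noteq> {}" using T \<open>n > 0\<close> by auto
  ultimately show ?thesis using T by (simp add: min_side_def)
qed

end
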